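(* Let $X$ be a compact Hausdorff space with compatible uniform structure $\mathscr{U}_X$. If $\pi\colon\mathbb{R}_+\times X\to X$, $(t,x)\mapsto t\cdot x$, is a minimal $C^0$-semiflow, then $$\inf_{x\in X}\ \liminf_{T_2-T_1\to\infty}\frac{1}{T_2-T_1}\int_{T_1}^{T_2}1_{\varepsilon[x]}(t\cdot x)\,dt>0$$ for all $\varepsilon\in\mathscr{U}_X$.
   Context: $\mathbb{R}_+=[0,\infty)$ with addition and the usual topology. A $C^0$-semiflow $\pi\colon\mathbb{R}_+\times X\to X$, $(t,x)\mapsto t\cdot x$, is a jointly continuous map with $0\cdot x=x$ and $(s+t)\cdot x=s\cdot(t\cdot x)$ for all $x\in X$, $s,t\in\mathbb{R}_+$. It is minimal if for every $x\in X$ the orbit $\{t\cdot x : t\in\mathbb{R}_+\}$ is dense in $X$. $\mathscr{U}_X$ is the unique compatible symmetric uniform structure on $X$; for $\varepsilon\in\mathscr{U}_X$, $\varepsilon[x]=\{y\in X : (x,y)\in\varepsilon\}$, which is an open neighborhood of $x$ (entourages are taken symmetric and open). $1_A$ is the indicator function of $A\subseteq X$. Here $0\le T_1<T_2$ are real numbers and $\liminf_{T_2-T_1\to\infty}$ means $\lim_{L\to\infty}\inf\{\cdot : T_2-T_1\ge L\}$. *)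

theory Defs
  imports "HOL-Analysis.Analysis"
begin

text \<open>
  Time is \<^typ>\<open>real\<close>; a semiflow is only constrained, and only ever evaluated, at times \<open>t \<ge> 0\<close>.
\<close>

definition semiflow :: "(real \<Rightarrow> 'a::topological_space \<Rightarrow> 'a) \<Rightarrow> bool" where
  "semiflow \<phi> \<longleftrightarrow>
     continuous_on ({0..} \<times> UNIV) (\<lambda>(t, x). \<phi> t x) \<and>
     (\<forall>x. \<phi> 0 x = x) \<and>
     (\<forall>s\<ge>0. \<forall>t\<ge>0. \<forall>x. \<phi> (s + t) x = \<phi> s (\<phi> t x))"

definition orbit :: "(real \<Rightarrow> 'a \<Rightarrow> 'a) \<Rightarrow> 'a \<Rightarrow> 'a set" where
  "orbit \<phi> x = {\<phi> t x | t. 0 \<le> t}"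

definition minimal_semiflow :: "(real \<Rightarrow> 'a::topological_space \<Rightarrow> 'a) \<Rightarrow> bool" where
  "minimal_semiflow \<phi> \<longleftrightarrow> semiflow \<phi> \<and> (\<forall>x. closure (orbit \<phi> x) = UNIV)"

text \<open>
  Compatibility of \<^const>\<open>uniformity\<close> with the topology is part of the class
  \<^class>\<open>uniform_space\<close>. By convention entourages are symmetric and open; such entourages
  form a base of the uniformity. For an entourage \<open>\<epsilon>\<close>, the neighbourhood \<open>\<epsilon>[x]\<close> is \<open>\<epsilon> `` {x}\<close>.
\<close>

definition entourages :: "('a::uniform_space \<times> 'a) set set" where
  "entourages = {\<epsilon>. (\<forall>\<^sub>F p in uniformity. p \<in> \<epsilon>) \<and> sym \<epsilon> \<and> open \<epsilon>}"

text \<open>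
  The lower limit over windows \<open>0 \<le> T\<^sub>1 < T\<^sub>2\<close> as \<open>T\<^sub>2 - T\<^sub>1 \<rightarrow> \<infinity>\<close>, uniform in the position of the
  window. It is taken in the complete lattice \<^typ>\<open>ereal\<close>, so the infima are always meaningful;
  the limit always exists by monotonicity, as shown below.
\<close>

definition window_inf :: "(real \<Rightarrow> real \<Rightarrow> ereal) \<Rightarrow> real \<Rightarrow> ereal" where
  "window_inf f L = Inf {f T\<^sub>1 T\<^sub>2 | T\<^sub>1 T\<^sub>2. 0 \<le> T\<^sub>1 \<and> T\<^sub>1 < T\<^sub>2 \<and> T\<^sub>2 - T\<^sub>1 \<ge> L}"

definition window_liminf :: "(real \<Rightarrow> real \<Rightarrow> ereal) \<Rightarrow> ereal" where
  "window_liminf f = Lim at_top (window_inf f)"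

lemma mono_window_inf: "mono (window_inf f)"
  unfolding mono_def window_inf_def by (intro allI impI Inf_superset_mono) fastforce

lemma tendsto_window_inf: "(window_inf f \<longlongrightarrow> (SUP L. window_inf f L)) at_top"
proof (rule order_tendstoI)
  fix a assume "a < (SUP L. window_inf f L)"
  then obtain L where "a < window_inf f L"
    by (auto simp: less_SUP_iff)
  then show "\<forall>\<^sub>F x in at_top. a < window_inf f x"
    using monoD[OF mono_window_inf] less_le_trans
    by (intro eventually_at_top_linorderI[of L]) blast
next
  fix a assume "(SUP L. window_inf f L) < a"
  then show "\<forall>\<^sub>F x in at_top. window_inf f x < a"
    by (intro always_eventually allI) (meson SUP_upper UNIV_I le_less_trans)
qed

lemma window_liminf_eq_SUP: "window_liminf f = (SUP L. window_inf f L)"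
  unfolding window_liminf_def by (rule tendsto_Lim[OF _ tendsto_window_inf]) simp

end

theory Submission
  imports Defs
begin

text \<open>
  By minimality the orbit of any point \<open>y\<close> meets \<open>\<epsilon>[x]\<close>, and by joint continuity it stays there
  for a while, with the same entry time and length of stay for all pairs near \<open>(x, y)\<close>. The pairs
  form a compact space, so there are \<open>N, r > 0\<close> such that every orbit, started anywhere, spends an
  interval of length \<open>r\<close> in \<open>\<epsilon>[x]\<close> before time \<open>N\<close> (\<open>minimal_semiflow_uniform_visits\<close>).
  Restarting the flow at the beginning of each block, every time block of length \<open>N\<close> contributes
  at least \<open>r\<close> to the integral. A window of length \<open>L \<ge> N\<close> contains at least \<open>L / (2 N)\<close> disjoint
  blocks, so its average is at least \<open>r / (2 N)\<close>, a bound that depends neither on the window nor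
  on \<open>x\<close>.

  Compactness is applied to pairs, rather than to \<open>y\<close> for a fixed target, because the target
  \<open>\<epsilon>[x]\<close> moves with \<open>x\<close>: this makes the bound uniform in \<open>x\<close> at once.
\<close>

lemma minimal_semiflow_visits:
  fixes \<phi> :: "real \<Rightarrow> 'a::topological_space \<Rightarrow> 'a"
  assumes "minimal_semiflow \<phi>" and "open U" and "U \<noteq> {}"
  obtains t where "0 \<le> t" and "\<phi> t y \<in> U"
proof -
  have "closure (orbit \<phi> y) = UNIV"
    using assms(1) by (simp add: minimal_semiflow_def)
  then have "U \<inter> orbit \<phi> y \<noteq> {}"
    using open_Int_closure_eq_empty[OF assms(2), of "orbit \<phi> y"] assms(3) by auto
  then show thesis
    using that by (auto simp: orbit_def)
qed

text \<open>
  The set of triples \<open>(x, t, y)\<close> with \<open>(x, \<phi> t y) \<in> E\<close> is open relative to \<open>t \<ge> 0\<close>, so a visit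
  persists under small changes of all three. The stay is measured to the right of the entry time
  \<open>t\<close> because \<open>t\<close> may be \<open>0\<close>, and nothing is known about the flow at negative times.
\<close>

lemma minimal_semiflow_local_visits:
  fixes \<phi> :: "real \<Rightarrow> 'a::topological_space \<Rightarrow> 'a"
  assumes min: "minimal_semiflow \<phi>" and "open E" and diag: "\<And>x. (x, x) \<in> E"
  obtains t r W where "0 \<le> t" and "0 < r" and "open W" and "(x, y) \<in> W"
    and "\<And>x' y' s. (x', y') \<in> W \<Longrightarrow> s \<in> {t..t + r} \<Longrightarrow> (x', \<phi> s y') \<in> E"
proof -
  let ?S = "UNIV \<times> ({0..} \<times> UNIV) :: ('a \<times> real \<times> 'a) set"
  let ?g = "\<lambda>p :: 'a \<times> real \<times> 'a. (fst p, \<phi> (fst (snd p)) (snd (snd p)))"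
  have "continuous_on ({0..} \<times> UNIV) (\<lambda>(t, x). \<phi> t x)"
    using min by (simp add: minimal_semiflow_def semiflow_def)
  then have "continuous_on ?S (\<lambda>p. (\<lambda>(t, x). \<phi> t x) (snd p))"
    by (rule continuous_on_compose2) (auto intro: continuous_intros)
  then have "continuous_on ?S ?g"
    by (auto simp: case_prod_beta intro!: continuous_intros)
  then obtain T where "open T" and T: "T \<inter> ?S = ?g -` E \<inter> ?S"
    using \<open>open E\<close> by (auto simp: continuous_on_open_invariant)
  have "open (Pair x -` E)"
    using \<open>open E\<close> by (intro open_vimage continuous_intros)
  moreover have "Pair x -` E \<noteq> {}"
    using diag by auto
  ultimately obtain t where t: "0 \<le> t" "\<phi> t y \<in> Pair x -` E"
    by (rule minimal_semiflow_visits[OF min])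
  then have "(x, t, y) \<in> ?g -` E \<inter> ?S"
    by simp
  then have "(x, t, y) \<in> T"
    using T by blast
  then obtain A B where AB: "open A" "open B" "x \<in> A" "(t, y) \<in> B" "A \<times> B \<subseteq> T"
    by (rule open_prod_elim[OF \<open>open T\<close>]) auto
  then obtain I C where IC: "open I" "open C" "t \<in> I" "y \<in> C" "I \<times> C \<subseteq> B"
    using open_prod_elim[OF \<open>open B\<close> \<open>(t, y) \<in> B\<close>] by (metis mem_Sigma_iff)
  obtain r where r: "r > 0" "cball t r \<subseteq> I"
    using IC open_contains_cball by blast
  show thesis
  proof
    show "open (A \<times> C)" "(x, y) \<in> A \<times> C"
      using AB IC by (auto intro: open_Times)
    fix x' y' s assume "(x', y') \<in> A \<times> C" and s: "s \<in> {t..t + r}"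
    moreover have "s \<in> I"
      using s r by (auto simp: dist_real_def subset_iff)
    ultimately have "(x', s, y') \<in> T \<inter> ?S"
      using AB IC t by auto
    then show "(x', \<phi> s y') \<in> E"
      unfolding T by simp
  qed (use t r in auto)
qed

text \<open>
  A finite subcover of the compact space of pairs leaves finitely many entry times and lengths of
  stay; the latest end of a stay serves as \<open>N\<close> and the shortest length as \<open>r\<close>.
\<close>

lemma minimal_semiflow_uniform_visits:
  fixes \<phi> :: "real \<Rightarrow> 'a::topological_space \<Rightarrow> 'a"
  assumes "compact (UNIV :: 'a set)"
    and "minimal_semiflow \<phi>" and "open E" and "\<And>x. (x, x) \<in> E"
  obtains N r :: real where "0 < N" and "0 < r"
    and "\<And>x y. \<exists>t\<ge>0. t + r \<le> N \<and> (\<forall>s\<in>{t..t + r}. (x, \<phi> s y) \<in> E)"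
proof -
  have "\<forall>p. \<exists>t r W. 0 \<le> t \<and> 0 < r \<and> open W \<and> p \<in> W \<and>
      (\<forall>x y s. (x, y) \<in> W \<longrightarrow> s \<in> {t..t + r} \<longrightarrow> (x, \<phi> s y) \<in> E)"
  proof
    fix p :: "'a \<times> 'a"
    show "\<exists>t r W. 0 \<le> t \<and> 0 < r \<and> open W \<and> p \<in> W \<and>
      (\<forall>x y s. (x, y) \<in> W \<longrightarrow> s \<in> {t..t + r} \<longrightarrow> (x, \<phi> s y) \<in> E)"
      by (rule minimal_semiflow_local_visits[OF assms(2-4), of "fst p" "snd p"])
        (simp, blast)
  qed
  then obtain t r W where
    trW: "\<And>p. 0 \<le> t p" "\<And>p. 0 < r p" "\<And>p. open (W p)" "\<And>p. p \<in> W p"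
    and visit: "\<And>p x y s. (x, y) \<in> W p \<Longrightarrow> s \<in> {t p..t p + r p} \<Longrightarrow> (x, \<phi> s y) \<in> E"
    by metis
  have "compact (UNIV :: ('a \<times> 'a) set)"
    using compact_Times[OF assms(1,1)] by simp
  then obtain D where D: "finite D" "UNIV \<subseteq> (\<Union>p\<in>D. W p)"
    by (rule compactE_image[where C = UNIV and f = W]) (use trW in auto)
  then have "D \<noteq> {}"
    by auto
  define r0 where "r0 = Min (r ` D)"
  define N where "N = Max ((\<lambda>p. t p + r p) ` D)"
  have bounds: "r0 \<le> r p" "t p + r p \<le> N" if "p \<in> D" for p
    using that D(1) by (auto simp: r0_def N_def)
  show thesis
  proof
    obtain p where "p \<in> D"
      using \<open>D \<noteq> {}\<close> by blast
    then show "0 < N"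
      using bounds(2)[of p] trW(1,2)[of p] by linarith
    show "0 < r0"
      using D(1) \<open>D \<noteq> {}\<close> trW by (simp add: r0_def)
    fix x y
    obtain p where p: "p \<in> D" "(x, y) \<in> W p"
      using D by blast
    have "(x, \<phi> s y) \<in> E" if "s \<in> {t p..t p + r0}" for s
      using that visit[OF p(2)] bounds(1)[OF p(1)] by auto
    then show "\<exists>t\<ge>0. t + r0 \<le> N \<and> (\<forall>s\<in>{t..t + r0}. (x, \<phi> s y) \<in> E)"
      using bounds[OF p(1)] trW(1) by (intro exI[of _ "t p"]) fastforce
  qed
qed

text \<open>
  Half-open blocks are pairwise disjoint, so that their contributions simply add up.
\<close>

lemma measure_blocks_ge:
  fixes A :: "real set"
  assumes A: "A \<in> sets borel" and "0 \<le> N" and "0 \<le> r"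
    and visit: "\<And>b. \<lbrakk>a \<le> b; b + N \<le> a + real n * N\<rbrakk> \<Longrightarrow> \<exists>t\<ge>b. t + r \<le> b + N \<and> {t..<t + r} \<subseteq> A"
  shows "real n * r \<le> measure lborel (A \<inter> {a..<a + real n * N})"
  using visit
proof (induction n)
  case 0
  then show ?case by simp
next
  case (Suc n)
  let ?b = "a + real n * N"
  have fin: "A \<inter> {c..<d} \<in> fmeasurable lborel" for c d
    by (rule fmeasurableI2[of "{c..d}"]) (use A in \<open>auto intro: fmeasurable_compact\<close>)
  obtain t where t: "?b \<le> t" "t + r \<le> ?b + N" "{t..<t + r} \<subseteq> A"
    using Suc.prems[of ?b] \<open>0 \<le> N\<close> by (auto simp: algebra_simps)
  have "r = measure lborel {t..<t + r}"
    using \<open>0 \<le> r\<close> by simp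
  also have "\<dots> \<le> measure lborel (A \<inter> {?b..<?b + N})"
    using t by (intro measure_mono_fmeasurable fin) auto
  finally have "r \<le> measure lborel (A \<inter> {?b..<?b + N})" .
  moreover have "real n * r \<le> measure lborel (A \<inter> {a..<?b})"
    using Suc.prems \<open>0 \<le> N\<close> by (intro Suc.IH) (auto simp: algebra_simps)
  moreover have "measure lborel (A \<inter> {a..<?b}) + measure lborel (A \<inter> {?b..<?b + N})
      = measure lborel (A \<inter> {a..<?b} \<union> A \<inter> {?b..<?b + N})"
    using fin by (subst measure_Un2) (auto intro!: arg_cong[where f = "measure lborel"])
  moreover have "A \<inter> {a..<?b} \<union> A \<inter> {?b..<?b + N} = A \<inter> {a..<a + real (Suc n) * N}"
  proof -
    have "a \<le> ?b" "?b \<le> ?b + N"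
      using \<open>0 \<le> N\<close> by simp_all
    then have "{a..<?b} \<union> {?b..<?b + N} = {a..<?b + N}"
      by (rule ivl_disj_un_two(3))
    moreover have "a + real (Suc n) * N = ?b + N"
      by (simp add: algebra_simps)
    ultimately show ?thesis
      by (simp only: Int_Un_distrib[symmetric])
  qed
  ultimately show ?case
    by (simp add: algebra_simps)
qed

lemma sojourn_times_borel:
  fixes \<phi> :: "real \<Rightarrow> 'a::topological_space \<Rightarrow> 'a"
  assumes "semiflow \<phi>" and "open U"
  shows "{t \<in> {0..}. \<phi> t x \<in> U} \<in> sets borel"
proof -
  have "continuous_on {0..} (\<lambda>t. (\<lambda>(t, x). \<phi> t x) (t, x))"
    using assms(1) unfolding semiflow_def
    by (intro continuous_on_compose2[of "{0..} \<times> UNIV" "\<lambda>(t, x). \<phi> t x" "{0..}" "\<lambda>t. (t, x)"]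
        continuous_intros) auto
  then obtain T where "open T" "T \<inter> {0..} = (\<lambda>t. \<phi> t x) -` U \<inter> {0..}"
    using assms(2) by (auto simp: continuous_on_open_invariant)
  then have "{t \<in> {0..}. \<phi> t x \<in> U} = T \<inter> {0..}" and "T \<in> sets borel"
    by auto
  then show ?thesis
    by simp
qed

text \<open>
  The hypothesis on \<open>U\<close> concerns all starting points, so it applies to \<open>\<phi> b x\<close> at the beginning \<open>b\<close>
  of every block; this is what makes the bound independent of the position of the window. The
  factor \<open>2\<close> pays for the incomplete block at the end of the window.
\<close>

lemma minimal_semiflow_average_bound:
  fixes \<phi> :: "real \<Rightarrow> 'a::topological_space \<Rightarrow> 'a"
  assumes flow: "semiflow \<phi>" and "open U" and "0 < N" and "0 \<le> r"
    and visit: "\<And>y. \<exists>t\<ge>0. t + r \<le> N \<and> (\<forall>s\<in>{t..t + r}. \<phi> s y \<in> U)"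
    and T: "0 \<le> T\<^sub>1" "N \<le> T\<^sub>2 - T\<^sub>1"
  shows "r / (2 * N) \<le> 1 / (T\<^sub>2 - T\<^sub>1) * (LBINT t:{T\<^sub>1..T\<^sub>2}. indicator U (\<phi> t x))"
proof -
  define A where "A = {t \<in> {0..}. \<phi> t x \<in> U}"
  define n where "n = nat \<lfloor>(T\<^sub>2 - T\<^sub>1) / N\<rfloor>"
  have A: "A \<in> sets borel"
    unfolding A_def by (rule sojourn_times_borel[OF flow \<open>open U\<close>])
  have "1 \<le> (T\<^sub>2 - T\<^sub>1) / N"
    using T \<open>0 < N\<close> by simp
  then have "1 \<le> n" and "real n = of_int \<lfloor>(T\<^sub>2 - T\<^sub>1) / N\<rfloor>"
    by (simp_all add: n_def le_nat_iff)
  \<comment> \<open>\<open>z < \<lfloor>z\<rfloor> + 1 \<le> 2 \<lfloor>z\<rfloor>\<close> for \<open>z \<ge> 1\<close>\<close>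
  then have n: "real n \<le> (T\<^sub>2 - T\<^sub>1) / N" "(T\<^sub>2 - T\<^sub>1) / N \<le> 2 * real n"
    by linarith+
  then have nN: "real n * N \<le> T\<^sub>2 - T\<^sub>1" "T\<^sub>2 - T\<^sub>1 \<le> 2 * real n * N"
    using \<open>0 < N\<close> by (simp_all add: field_simps)
  have block: "\<exists>t\<ge>b. t + r \<le> b + N \<and> {t..<t + r} \<subseteq> A" if "T\<^sub>1 \<le> b" for b
  proof -
    have "0 \<le> b"
      using that T by simp
    obtain t where t: "0 \<le> t" "t + r \<le> N" "\<forall>s\<in>{t..t + r}. \<phi> s (\<phi> b x) \<in> U"
      using visit by blast
    have "{b + t..<b + t + r} \<subseteq> A"
    proof
      fix s assume s: "s \<in> {b + t..<b + t + r}"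
      then have "0 \<le> s - b"
        using t(1) by simp
      then have "\<phi> ((s - b) + b) x = \<phi> (s - b) (\<phi> b x)"
        using flow \<open>0 \<le> b\<close> unfolding semiflow_def by blast
      then show "s \<in> A"
        using s t \<open>0 \<le> b\<close> by (auto simp: A_def)
    qed
    then show ?thesis
      using t by (intro exI[of _ "b + t"]) auto
  qed
  have "real n * r \<le> measure lborel (A \<inter> {T\<^sub>1..<T\<^sub>1 + real n * N})"
    using A \<open>0 < N\<close> \<open>0 \<le> r\<close> block by (intro measure_blocks_ge) auto
  also have "\<dots> \<le> measure lborel (A \<inter> {T\<^sub>1..T\<^sub>2})"
  proof (rule measure_mono_fmeasurable)
    show "A \<inter> {T\<^sub>1..T\<^sub>2} \<in> fmeasurable lborel"
      by (rule fmeasurableI2[of "{T\<^sub>1..T\<^sub>2}"]) (use A in \<open>auto intro: fmeasurable_compact\<close>)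
  qed (use A nN in auto)
  also have "\<dots> = (LBINT t. indicator (A \<inter> {T\<^sub>1..T\<^sub>2}) t)"
    by simp
  also have "\<dots> = (LBINT t:{T\<^sub>1..T\<^sub>2}. indicator U (\<phi> t x))"
    using T unfolding set_lebesgue_integral_def
    by (intro Bochner_Integration.integral_cong) (auto simp: A_def indicator_def)
  finally have "real n * r \<le> (LBINT t:{T\<^sub>1..T\<^sub>2}. indicator U (\<phi> t x))" .
  moreover have "r * (T\<^sub>2 - T\<^sub>1) \<le> r * (2 * real n * N)"
    using nN(2) \<open>0 \<le> r\<close> by (rule mult_left_mono)
  then have "r / (2 * N) * (T\<^sub>2 - T\<^sub>1) \<le> real n * r"
    using \<open>0 < N\<close> by (simp add: field_simps)
  ultimately have "r / (2 * N) * (T\<^sub>2 - T\<^sub>1) \<le> (LBINT t:{T\<^sub>1..T\<^sub>2}. indicator U (\<phi> t x))"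
    by linarith
  moreover have "0 < T\<^sub>2 - T\<^sub>1"
    using T \<open>0 < N\<close> by linarith
  ultimately show ?thesis
    by (simp add: pos_le_divide_eq)
qed

theorem theorem3p3:
  fixes \<phi> :: "real \<Rightarrow> 'a::{uniform_space, t2_space} \<Rightarrow> 'a"
  assumes "compact (UNIV :: 'a set)"
    and "minimal_semiflow \<phi>"
  shows "\<forall>\<epsilon> \<in> entourages.
    (INF x. window_liminf (\<lambda>T\<^sub>1 T\<^sub>2.
       ereal (1 / (T\<^sub>2 - T\<^sub>1) * (LBINT t:{T\<^sub>1..T\<^sub>2}. indicator (\<epsilon> `` {x}) (\<phi> t x))))) > 0"
proof
  fix \<epsilon> :: "('a \<times> 'a) set"
  assume "\<epsilon> \<in> entourages"
  then have "open \<epsilon>" and "\<forall>\<^sub>F p in uniformity. p \<in> \<epsilon>"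
    by (auto simp: entourages_def)
  then have "(x, x) \<in> \<epsilon>" for x
    using uniformity_refl by fastforce
  then obtain N r where "0 < N" "0 < r"
    and visit: "\<And>x y. \<exists>t\<ge>0. t + r \<le> N \<and> (\<forall>s\<in>{t..t + r}. (x, \<phi> s y) \<in> \<epsilon>)"
    using minimal_semiflow_uniform_visits[OF assms \<open>open \<epsilon>\<close>] by blast
  let ?f = "\<lambda>x T\<^sub>1 T\<^sub>2. ereal (1 / (T\<^sub>2 - T\<^sub>1) * (LBINT t:{T\<^sub>1..T\<^sub>2}. indicator (\<epsilon> `` {x}) (\<phi> t x)))"
  have "ereal (r / (2 * N)) \<le> window_liminf (?f x)" for x
  proof -
    have "open (Pair x -` \<epsilon>)"
      using \<open>open \<epsilon>\<close> by (intro open_vimage continuous_intros)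
    also have "Pair x -` \<epsilon> = \<epsilon> `` {x}"
      by auto
    finally have "open (\<epsilon> `` {x})" .
    moreover have "semiflow \<phi>"
      using assms(2) by (simp add: minimal_semiflow_def)
    ultimately have "ereal (r / (2 * N)) \<le> ?f x T\<^sub>1 T\<^sub>2" if "0 \<le> T\<^sub>1" "N \<le> T\<^sub>2 - T\<^sub>1" for T\<^sub>1 T\<^sub>2
      unfolding ereal_less_eq using that \<open>0 < N\<close> \<open>0 < r\<close> visit
      by (intro minimal_semiflow_average_bound) auto
    then have "ereal (r / (2 * N)) \<le> window_inf (?f x) N"
      unfolding window_inf_def by (intro Inf_greatest) auto
    also have "\<dots> \<le> window_liminf (?f x)"
      unfolding window_liminf_eq_SUP by (rule SUP_upper) simp
    finally show ?thesis .
  qed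
  then have "ereal (r / (2 * N)) \<le> (INF x. window_liminf (?f x))"
    by (rule INF_greatest)
  moreover have "0 < ereal (r / (2 * N))"
    using \<open>0 < N\<close> \<open>0 < r\<close> by simp
  ultimately show "0 < (INF x. window_liminf (?f x))"
    by (rule less_le_trans[rotated])
qed

end
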